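(* Fix a mesh $\mathcal{T}_h$, $\gamma>0$ and $\nu\ge0$, and consider the discrete penalized problem $$(Q_h^\gamma)\qquad\min_{\boldsymbol{u}\in\mathbb{R}^{N_{\mathbb{B}}}}\ \tfrac12\boldsymbol{u}^T\mathcal{A}\boldsymbol{u}-\boldsymbol{f}^T\boldsymbol{u}+\frac1{2\gamma}\sum_{j\in\mathbb{J}}\mathcal{L}_{j,j}\max\{0,\mu^*_j+\gamma((\mathcal{S}\boldsymbol{u})_j-b_j)\}^2.$$ Consider the semismooth Newton method: given $\boldsymbol{u}_0\in\mathbb{R}^{N_{\mathbb{B}}}$, for $k=0,1,2,\dots$ set $\mathcal{H}=\mathcal{H}(\boldsymbol{u}_k)$ and let $\boldsymbol{u}_{k+1}$ be the solution of $$(\mathcal{A}+\gamma\,\mathcal{S}^T\mathcal{H}\mathcal{S})\boldsymbol{u}_{k+1}=\boldsymbol{f}+\mathcal{S}^T\mathcal{H}(\gamma\boldsymbol{b}-\boldsymbol{\mu}^* ).$$ This method converges locally q-superlinearly: if $\boldsymbol{u}_0$ is close enough to the solution of $(Q_h^\gamma)$, then $(\boldsymbol{u}_k)$ converges q-superlinearly to that solution.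
   Context: $\Omega\subset\mathbb{R}^2$ is a bounded convex domain with polygonal boundary $\Gamma$, $\omega$ is a domain with $\bar\omega\subset\Omega$, $b\in C(\bar\omega)$, $y_\Omega\in L^2(\Omega)$, and $\mathcal{T}_h$ is a triangulation of $\bar\Omega$. $Y_h=\{y_h\in C(\bar\Omega): y_h|_T\in P^1(T)\ \forall T\in\mathcal{T}_h\}$, with nodes $x_1,\dots,x_N$ and nodal basis $e_1,\dots,e_N$. $\mathbb{I}=\{j:x_j\in\Omega\}$, $\mathbb{B}=\{j:x_j\in\Gamma\}$, $\mathbb{J}=\{j:x_j\in\bar\omega\}$; $N_{\mathbb{I}}$, $N_{\mathbb{B}}$ are the cardinalities of $\mathbb{I},\mathbb{B}$; vectors in $\mathbb{R}^N$ are ordered with interior indexes first. $\mathcal{K}_{i,j}=\int_\Omega\nabla e_i\cdot\nabla e_j\,dx$, $\mathcal{M}_{i,j}=\int_\Omega e_ie_j\,dx$, $\mathcal{B}_{i,j}=\int_\Gamma e_ie_j\,ds$. $\mathcal{I}$, $\mathcal{O}$ are the $N\times N$ identity and zero matrices; index sets in subscripts denote submatrices, ":" meaning all indexes. $\mathcal{S}=\begin{pmatrix}\mathcal{K}_{\mathbb{I},\mathbb{I}}&\mathcal{K}_{\mathbb{I},\mathbb{B}}\\ \mathcal{O}_{\mathbb{B},\mathbb{I}}&\mathcal{I}_{\mathbb{B},\mathbb{B}}\end{pmatrix}^{-1}\mathcal{I}_{:,\mathbb{B}}\in\mathbb{R}^{N\times N_{\mathbb{B}}}$, $\mathcal{A}=\mathcal{S}^T\mathcal{M}\mathcal{S}+\nu\mathcal{B}_{\mathbb{B},\mathbb{B}}$,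 $\boldsymbol{f}=\mathcal{S}^T\mathcal{M}\boldsymbol{y}_\Omega$, where $\boldsymbol{y}_\Omega\in\mathbb{R}^N$ is the vector of nodal values of the $L^2(\Omega)$-projection of $y_\Omega$ onto $Y_h$. $\mathcal{L}\in\mathbb{R}^{N\times N}$ is diagonal with $\mathcal{L}_{j,j}=\sum_{k=1}^N\mathcal{M}_{k,j}$ if $j\in\mathbb{J}$ and $\mathcal{L}_{j,j}=0$ otherwise. $\boldsymbol{\mu}^*\in\mathbb{R}^N$ is the nodal vector of a shift function $\mu^*\in Y_h$ with $\mu^*(x_j)=0$ for $j\notin\mathbb{J}$; $\boldsymbol{b}\in\mathbb{R}^N$ has $b_j=b(x_j)$ for $j\in\mathbb{J}$ (other entries are irrelevant). $\mathcal{H}(\boldsymbol{u})\in\mathbb{R}^{N\times N}$ is diagonal with $\mathcal{H}_{j,j}=\mathcal{L}_{j,j}$ if $j\in\mathbb{J}$ and $\mu^*_j+\gamma((\mathcal{S}\boldsymbol{u})_j-b_j)>0$, and $\mathcal{H}_{j,j}=0$ otherwise. Up to an additive constant the quadratic part $\frac12\boldsymbol{u}^T\mathcal{A}\boldsymbol{u}-\boldsymbol{f}^T\boldsymbol{u}$ equals the discrete control functional $\frac12\|S_hu_h-y_\Omega\|^2_{L^2(\Omega)}+\frac\nu2\|u_h\|^2_{L^2(\Gamma)}$, where $u_h=\sum_{j\in\mathbb{B}}u_je_j$ and $S_hu_h$ is its discrete harmonic extension with nodal vector $\mathcal{S}\boldsymbol{u}$. *)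

theory Defs
  imports "HOL-Analysis.Analysis" "HOL-Library.Landau_Symbols"
begin

definition domain :: "(real^2) set \<Rightarrow> bool" where
  "domain D \<longleftrightarrow> open D \<and> connected D \<and> D \<noteq> {}"

definition polygonal_boundary :: "(real^2) set \<Rightarrow> bool" where
  "polygonal_boundary D \<longleftrightarrow>
     (\<exists>F. finite F \<and> (\<forall>s\<in>F. \<exists>p q. s = closed_segment p q) \<and> frontier D = \<Union>F)"

definition square_integrable_on :: "(real^2) set \<Rightarrow> (real^2 \<Rightarrow> real) \<Rightarrow> bool" where
  "square_integrable_on D g \<longleftrightarrow>
     set_borel_measurable lebesgue D g \<and> set_integrable lebesgue D (\<lambda>z. (g z)\<^sup>2)"

text \<open>The library's \<^const>\<open>triangulation\<close> is a finite set of simplices (of any dimension) any two of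
  which meet in a common face; here all of them are triangles and they cover the closure of the
  domain.\<close>

definition mesh_of :: "(real^2) set \<Rightarrow> (real^2) set set \<Rightarrow> bool" where
  "mesh_of D \<T> \<longleftrightarrow> triangulation \<T> \<and> (\<forall>T\<in>\<T>. 2 simplex T) \<and> \<Union>\<T> = closure D"

definition mesh_nodes :: "(real^2) set set \<Rightarrow> (real^2) set" where
  "mesh_nodes \<T> = {v. \<exists>T\<in>\<T>. v extreme_point_of T}"

text \<open>The finite element space \<open>Y\<^sub>h\<close>. Its members are represented by functions on the whole plane,
  of which only the values on the closure of the domain matter.\<close>

definition fe_space :: "(real^2) set \<Rightarrow> (real^2) set set \<Rightarrow> (real^2 \<Rightarrow> real) set" where
  "fe_space D \<T> =
     {y. continuous_on (closure D) y \<and> (\<forall>T\<in>\<T>. \<exists>a c. \<forall>z\<in>T. y z = a \<bullet> z + c)}"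

definition nodal_basis ::
  "(real^2) set \<Rightarrow> (real^2) set set \<Rightarrow> ('n \<Rightarrow> real^2) \<Rightarrow> ('n \<Rightarrow> real^2 \<Rightarrow> real) \<Rightarrow> bool" where
  "nodal_basis D \<T> x e \<longleftrightarrow>
     (\<forall>j. e j \<in> fe_space D \<T>) \<and> (\<forall>i j. e j (x i) = (if i = j then 1 else 0))"

definition L2_projection ::
  "(real^2) set \<Rightarrow> (real^2) set set \<Rightarrow> (real^2 \<Rightarrow> real) \<Rightarrow> (real^2 \<Rightarrow> real) \<Rightarrow> bool" where
  "L2_projection D \<T> y p \<longleftrightarrow>
     p \<in> fe_space D \<T> \<and> (\<forall>w\<in>fe_space D \<T>. (LINT z:D|lebesgue. (y z - p z) * w z) = 0)"

definition nodal_vector :: "('n \<Rightarrow> real^2) \<Rightarrow> (real^2 \<Rightarrow> real) \<Rightarrow> real^'n::finite" where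
  "nodal_vector x g = (\<chi> j. g (x j))"

text \<open>The value where \<open>g\<close> is not differentiable is arbitrary; for members of \<open>Y\<^sub>h\<close> this can only
  happen, inside the domain, on the edges of the triangles, a null set.\<close>

definition gradient :: "(real^2 \<Rightarrow> real) \<Rightarrow> real^2 \<Rightarrow> real^2" where
  "gradient g z = (THE d. GDERIV g z :> d)"

definition segment_integral :: "real^2 \<Rightarrow> real^2 \<Rightarrow> (real^2 \<Rightarrow> real) \<Rightarrow> real" where
  "segment_integral p q g = dist p q * (LINT t:{0..1}|lebesgue. g (linepath p q t))"

text \<open>The arc length integral over the boundary of a convex polygonal domain, as the sum over the
  sides of the polygon. The end points \<open>p\<close>, \<open>q\<close> of a side are determined up to exchange,
  which does not affect the integral.\<close>

definition boundary_integral :: "(real^2) set \<Rightarrow> (real^2 \<Rightarrow> real) \<Rightarrow> real" where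
  "boundary_integral D g =
     (\<Sum>E | E edge_of closure D.
        let (p, q) = (SOME (p, q). E = closed_segment p q) in segment_integral p q g)"

definition stiffness_matrix ::
  "(real^2) set \<Rightarrow> ('n \<Rightarrow> real^2 \<Rightarrow> real) \<Rightarrow> real^'n^'n::finite" where
  "stiffness_matrix D e = (\<chi> i j. LINT z:D|lebesgue. gradient (e i) z \<bullet> gradient (e j) z)"

definition mass_matrix ::
  "(real^2) set \<Rightarrow> ('n \<Rightarrow> real^2 \<Rightarrow> real) \<Rightarrow> real^'n^'n::finite" where
  "mass_matrix D e = (\<chi> i j. LINT z:D|lebesgue. e i z * e j z)"

definition boundary_mass_matrix ::
  "(real^2) set \<Rightarrow> ('n \<Rightarrow> real^2 \<Rightarrow> real) \<Rightarrow> real^'n^'n::finite" where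
  "boundary_mass_matrix D e = (\<chi> i j. boundary_integral D (\<lambda>z. e i z * e j z))"

definition submatrix_via ::
  "real^'n^'m \<Rightarrow> ('a \<Rightarrow> 'm) \<Rightarrow> ('b \<Rightarrow> 'n) \<Rightarrow> real^'b::finite^'a::finite" where
  "submatrix_via X r c = (\<chi> i j. X $ r i $ c j)"

text \<open>The block matrix with the rows of the stiffness matrix for the interior nodes and the rows of
  the identity for the others. Listing the interior nodes first would only permute rows and columns
  simultaneously.\<close>

definition dirichlet_matrix ::
  "(real^2) set \<Rightarrow> ('n \<Rightarrow> real^2) \<Rightarrow> ('n \<Rightarrow> real^2 \<Rightarrow> real) \<Rightarrow> real^'n^'n::finite" where
  "dirichlet_matrix D x e =
     (\<chi> i j. if x i \<in> D then stiffness_matrix D e $ i $ j else mat 1 $ i $ j)"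

text \<open>In the following \<open>\<beta>\<close> enumerates the indices of the boundary nodes, so that the vectors
  indexed by boundary nodes form the type \<^typ>\<open>real^'b\<close>.\<close>

definition harmonic_extension_matrix ::
  "(real^2) set \<Rightarrow> ('n \<Rightarrow> real^2) \<Rightarrow> ('b \<Rightarrow> 'n) \<Rightarrow> ('n \<Rightarrow> real^2 \<Rightarrow> real)
     \<Rightarrow> real^'b::finite^'n::finite" where
  "harmonic_extension_matrix D x \<beta> e =
     matrix_inv (dirichlet_matrix D x e) ** submatrix_via (mat 1) id \<beta>"

definition control_matrix ::
  "(real^2) set \<Rightarrow> ('n \<Rightarrow> real^2) \<Rightarrow> ('b \<Rightarrow> 'n) \<Rightarrow> ('n::finite \<Rightarrow> real^2 \<Rightarrow> real) \<Rightarrow> real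
     \<Rightarrow> real^'b::finite^'b" where
  "control_matrix D x \<beta> e \<nu> =
     (let S = harmonic_extension_matrix D x \<beta> e in
      transpose S ** mass_matrix D e ** S
        + \<nu> *\<^sub>R submatrix_via (boundary_mass_matrix D e) \<beta> \<beta>)"

definition lumped_matrix ::
  "(real^2) set \<Rightarrow> ('n \<Rightarrow> real^2 \<Rightarrow> real) \<Rightarrow> 'n set \<Rightarrow> real^'n^'n::finite" where
  "lumped_matrix D e J =
     (\<chi> i j. if i = j \<and> j \<in> J then \<Sum>k\<in>UNIV. mass_matrix D e $ k $ j else 0)"

definition active_matrix ::
  "real^'b^'n \<Rightarrow> real^'n^'n \<Rightarrow> 'n set \<Rightarrow> real^'n \<Rightarrow> real^'n \<Rightarrow> real \<Rightarrow> real^'b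
     \<Rightarrow> real^'n^'n" where
  "active_matrix S L J m b \<gamma> u =
     (\<chi> i j. if i = j \<and> j \<in> J \<and> m $ j + \<gamma> * ((S *v u) $ j - b $ j) > 0
             then L $ j $ j else 0)"

definition penalized_objective ::
  "real^'b^'b \<Rightarrow> real^'b \<Rightarrow> real^'b^'n \<Rightarrow> real^'n^'n \<Rightarrow> 'n set \<Rightarrow> real^'n \<Rightarrow> real^'n
     \<Rightarrow> real \<Rightarrow> real^'b \<Rightarrow> real" where
  "penalized_objective A f S L J m b \<gamma> u =
     1 / 2 * (u \<bullet> (A *v u)) - f \<bullet> u
       + 1 / (2 * \<gamma>) * (\<Sum>j\<in>J. L $ j $ j * (max 0 (m $ j + \<gamma> * ((S *v u) $ j - b $ j)))\<^sup>2)"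

definition newton_step ::
  "real^'b^'b \<Rightarrow> real^'b \<Rightarrow> real^'b^'n \<Rightarrow> real^'n^'n \<Rightarrow> 'n set \<Rightarrow> real^'n \<Rightarrow> real^'n
     \<Rightarrow> real \<Rightarrow> real^'b \<Rightarrow> real^'b \<Rightarrow> bool" where
  "newton_step A f S L J m b \<gamma> u v \<longleftrightarrow>
     (let H = active_matrix S L J m b \<gamma> u in
      (A + \<gamma> *\<^sub>R (transpose S ** H ** S)) *v v
        = f + transpose S *v (H *v (\<gamma> *\<^sub>R b - m)))"

definition global_minimizer :: "('a \<Rightarrow> real) \<Rightarrow> 'a \<Rightarrow> bool" where
  "global_minimizer q u \<longleftrightarrow> (\<forall>v. q u \<le> q v)"

text \<open>Stated with \<open>o\<close> rather than with quotients, so that the limit may be reached after finitely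
  many steps.\<close>

definition converges_q_superlinearly :: "(nat \<Rightarrow> 'a::real_normed_vector) \<Rightarrow> 'a \<Rightarrow> bool" where
  "converges_q_superlinearly u l \<longleftrightarrow>
     u \<longlonglongrightarrow> l \<and> (\<lambda>k. norm (u (Suc k) - l)) \<in> o(\<lambda>k. norm (u k - l))"

end

theory Submission
  imports Defs
begin

text \<open>The objective is strictly convex and piecewise quadratic, with a piecewise affine gradient. A
  Newton step from \<open>u\<close> solves the affine equation of a piece containing \<open>u\<close>. If \<open>u\<close> is close enough
  to the minimizer, the closure of that piece contains the minimizer, which therefore solves the
  same equation: the method is exact after one step. What remains is that the control matrix is
  positive definite and the lumped weights are nonnegative. The former holds because the mass matrix
  is a Gram matrix and the discrete harmonic extension is well defined and injective, which in turn
  uses that a finite element function with vanishing gradient is constant and that there is a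
  boundary node. The latter holds because the nodal basis functions are nonnegative.\<close>

section \<open>The penalized problem for a positive definite matrix\<close>

text \<open>The function \<open>(max 0 a)\<^sup>2\<close> has derivative \<open>2 * max 0 a\<close>,
  which is Lipschitz with constant 2, so the second-order remainder is at most
  \<open>h\<^sup>2\<close>.\<close>

lemma max_0_square_upper:
  fixes a h :: real
  shows "(max 0 (a + h))\<^sup>2 \<le> (max 0 a)\<^sup>2 + 2 * max 0 a * h + h\<^sup>2"
proof (cases "a \<ge> 0")
  case True
  have "(max 0 (a + h))\<^sup>2 \<le> (a + h)\<^sup>2" by (simp add: max_def)
  with True show ?thesis by (simp add: power2_sum)
next
  case False
  then have "\<bar>max 0 (a + h)\<bar> \<le> \<bar>h\<bar>" by (auto simp: max_def)
  then have "(max 0 (a + h))\<^sup>2 \<le> h\<^sup>2" by (simp only: abs_le_square_iff)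
  with False show ?thesis by simp
qed

text \<open>Convexity: the graph lies above its tangents.\<close>

lemma max_0_square_lower:
  fixes a h :: real
  shows "(max 0 a)\<^sup>2 + 2 * max 0 a * h \<le> (max 0 (a + h))\<^sup>2"
proof (cases "a \<ge> 0")
  case True
  have "a\<^sup>2 + 2 * a * h \<le> (max 0 (a + h))\<^sup>2"
  proof (cases "a + h \<ge> 0")
    case True
    then show ?thesis by (simp add: power2_sum)
  next
    case False
    then have "a * (a + h) \<le> 0" "a * h \<le> 0"
      using \<open>a \<ge> 0\<close> by (auto intro: mult_nonneg_nonpos)
    with False show ?thesis by (simp add: power2_eq_square algebra_simps)
  qed
  with True show ?thesis by simp
qed simp

text \<open>The constant is the minimum of the form over the compact unit sphere; homogeneity of
  degree 2 extends the bound to all vectors.\<close>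

lemma pos_def_coercive:
  fixes A :: "real^'b::finite^'b"
  assumes "\<And>v. v \<noteq> 0 \<Longrightarrow> 0 < v \<bullet> (A *v v)"
  obtains c where "c > 0" "\<And>v. c * (norm v)\<^sup>2 \<le> v \<bullet> (A *v v)"
proof -
  have "sphere (0::real^'b) 1 \<noteq> {}" by simp
  moreover have "continuous_on (sphere 0 1) (\<lambda>v. v \<bullet> (A *v v))"
    by (intro continuous_intros matrix_vector_mult_linear_continuous_on)
  ultimately obtain w where w: "w \<in> sphere 0 1"
    and min: "\<And>v. v \<in> sphere 0 1 \<Longrightarrow> w \<bullet> (A *v w) \<le> v \<bullet> (A *v v)"
    using continuous_attains_inf[OF compact_sphere] by blast
  have "w \<noteq> 0" using w by auto
  show ?thesis
  proof
    show "w \<bullet> (A *v w) > 0" using assms \<open>w \<noteq> 0\<close> by blast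
    show "w \<bullet> (A *v w) * (norm v)\<^sup>2 \<le> v \<bullet> (A *v v)" for v
    proof (cases "v = 0")
      case False
      let ?s = "v /\<^sub>R norm v"
      have "?s \<bullet> (A *v ?s) = (v \<bullet> (A *v v)) / (norm v)\<^sup>2"
        by (simp add: matrix_vector_mult_scaleR power2_eq_square divide_inverse)
      moreover have "w \<bullet> (A *v w) \<le> ?s \<bullet> (A *v ?s)"
        using False by (intro min) simp
      ultimately show ?thesis using False by (simp add: pos_le_divide_eq)
    qed simp
  qed
qed

lemma linear_coefficient_eq_0:
  fixes a C :: real
  assumes "\<And>t. 0 \<le> t * a + t\<^sup>2 * C"
  shows "a = 0"
proof (rule ccontr)
  assume "a \<noteq> 0"
  \<comment> \<open>\<open>K\<close> is a positive upper bound of \<open>C\<close>, and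
    \<open>t\<close> is the minimizer of \<open>t * a + t\<^sup>2 * K\<close>, with the negative
    value \<open>- (a\<^sup>2 / (4 * K))\<close>.\<close>
  define K where "K = \<bar>C\<bar> + 1"
  define t where "t = - a / (2 * K)"
  have K: "K > 0" "C \<le> K" by (auto simp: K_def)
  have "t * a + t\<^sup>2 * C \<le> t * a + t\<^sup>2 * K"
    using K by (intro add_left_mono mult_left_mono) auto
  also have "\<dots> = - (a\<^sup>2 / (4 * K))"
    using K by (simp add: t_def power2_eq_square field_simps)
  also have "\<dots> < 0" using K \<open>a \<noteq> 0\<close> by simp
  finally show False using assms[of t] by simp
qed

section \<open>The penalized objective and its unique minimizer\<close>

text \<open>The optimization argument sees the discretization only through these properties of the
  matrices.\<close>

locale penalized_problem =
  fixes A :: "real^'b::finite^'b" and f :: "real^'b" and S :: "real^'b^'n::finite"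
    and L :: "real^'n^'n" and J :: "'n set" and m b :: "real^'n" and \<gamma> :: real
  assumes symmetric: "transpose A = A"
    and pos_def: "v \<noteq> 0 \<Longrightarrow> 0 < v \<bullet> (A *v v)"
    and weight_nonneg: "j \<in> J \<Longrightarrow> 0 \<le> L $ j $ j"
    and \<gamma>_pos: "\<gamma> > 0"
begin

abbreviation "Q \<equiv> penalized_objective A f S L J m b \<gamma>"

abbreviation "step \<equiv> newton_step A f S L J m b \<gamma>"

definition shifted :: "real^'b \<Rightarrow> real^'n" where
  "shifted u = m + \<gamma> *\<^sub>R (S *v u - b)"

text \<open>The gradient of \<open>Q\<close>: the chain rule factor \<open>2 * \<gamma>\<close>
  cancels the penalty factor \<open>1 / (2 * \<gamma>)\<close>. Differentiability is never invoked;
  \<open>Q_lower\<close> and \<open>Q_upper\<close> express the link to \<open>Q\<close>.\<close>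

definition gradQ :: "real^'b \<Rightarrow> real^'b" where
  "gradQ u = A *v u - f
     + transpose S *v (\<chi> j. if j \<in> J then L $ j $ j * max 0 (shifted u $ j) else 0)"

lemma shifted_add: "shifted (u + d) $ j = shifted u $ j + \<gamma> * (S *v d) $ j"
  by (simp add: shifted_def matrix_vector_right_distrib algebra_simps)

lemma Q_eq:
  "Q u = 1 / 2 * (u \<bullet> (A *v u)) - f \<bullet> u
     + (\<Sum>j\<in>J. L $ j $ j / (2 * \<gamma>) * (max 0 (shifted u $ j))\<^sup>2)"
  by (simp add: penalized_objective_def shifted_def sum_distrib_left field_simps)

lemma inner_gradQ:
  "gradQ u \<bullet> d = d \<bullet> (A *v u) - f \<bullet> d
     + (\<Sum>j\<in>J. L $ j $ j * max 0 (shifted u $ j) * (S *v d) $ j)"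
proof -
  let ?w = "\<chi> j. if j \<in> J then L $ j $ j * max 0 (shifted u $ j) else 0"
  have "(transpose S *v ?w) \<bullet> d = ?w \<bullet> (S *v d)"
    by (simp add: dot_lmul_matrix)
  also have "\<dots> = (\<Sum>j\<in>UNIV. if j \<in> J then L $ j $ j * max 0 (shifted u $ j) * (S *v d) $ j else 0)"
    unfolding inner_vec_def by (rule sum.cong) auto
  also have "\<dots> = (\<Sum>j\<in>J. L $ j $ j * max 0 (shifted u $ j) * (S *v d) $ j)"
    by (simp add: sum.If_cases)
  finally show ?thesis
    unfolding gradQ_def inner_add_left inner_diff_left by (simp add: inner_commute)
qed

text \<open>Symmetry of \<open>A\<close> merges the two cross terms.\<close>

lemma quadratic_add:
  "(u + d) \<bullet> (A *v (u + d)) = u \<bullet> (A *v u) + 2 * (d \<bullet> (A *v u)) + d \<bullet> (A *v d)"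
proof -
  have "u \<bullet> (A *v d) = d \<bullet> (A *v u)"
    using dot_lmul_matrix[of u A d] symmetric transpose_matrix_vector[of A u]
    by (simp add: inner_commute)
  then show ?thesis by (simp add: matrix_vector_right_distrib inner_add)
qed

text \<open>The quadratic part is expanded exactly and the penalty is bounded by its tangent. This
  yields both growth at infinity and strict convexity.\<close>

lemma Q_lower: "Q u + gradQ u \<bullet> d + 1 / 2 * (d \<bullet> (A *v d)) \<le> Q (u + d)"
proof -
  have "(\<Sum>j\<in>J. L $ j $ j / (2 * \<gamma>) * (max 0 (shifted u $ j))\<^sup>2)
      + (\<Sum>j\<in>J. L $ j $ j * max 0 (shifted u $ j) * (S *v d) $ j)
    = (\<Sum>j\<in>J. L $ j $ j / (2 * \<gamma>)
        * ((max 0 (shifted u $ j))\<^sup>2 + 2 * max 0 (shifted u $ j) * (\<gamma> * (S *v d) $ j)))"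
    using \<gamma>_pos by (simp add: sum.distrib[symmetric] field_simps)
  also have "\<dots> \<le> (\<Sum>j\<in>J. L $ j $ j / (2 * \<gamma>) * (max 0 (shifted (u + d) $ j))\<^sup>2)"
    unfolding shifted_add using \<gamma>_pos weight_nonneg
    by (intro sum_mono mult_left_mono max_0_square_lower) auto
  finally show ?thesis
    unfolding Q_eq inner_gradQ quadratic_add by (simp add: inner_add_right field_simps)
qed

lemma Q_upper:
  "Q (u + d) \<le> Q u + gradQ u \<bullet> d + 1 / 2 * (d \<bullet> (A *v d))
     + (\<Sum>j\<in>J. L $ j $ j * \<gamma> / 2 * ((S *v d) $ j)\<^sup>2)"
proof -
  have "(\<Sum>j\<in>J. L $ j $ j / (2 * \<gamma>) * (max 0 (shifted (u + d) $ j))\<^sup>2)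
    \<le> (\<Sum>j\<in>J. L $ j $ j / (2 * \<gamma>) * ((max 0 (shifted u $ j))\<^sup>2
        + 2 * max 0 (shifted u $ j) * (\<gamma> * (S *v d) $ j) + (\<gamma> * (S *v d) $ j)\<^sup>2))"
    unfolding shifted_add using \<gamma>_pos weight_nonneg
    by (intro sum_mono mult_left_mono max_0_square_upper) auto
  also have "\<dots> = (\<Sum>j\<in>J. L $ j $ j / (2 * \<gamma>) * (max 0 (shifted u $ j))\<^sup>2)
      + (\<Sum>j\<in>J. L $ j $ j * max 0 (shifted u $ j) * (S *v d) $ j)
      + (\<Sum>j\<in>J. L $ j $ j * \<gamma> / 2 * ((S *v d) $ j)\<^sup>2)"
    using \<gamma>_pos by (simp add: sum.distrib[symmetric] power2_eq_square field_simps)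
  finally show ?thesis
    unfolding Q_eq inner_gradQ quadratic_add by (simp add: inner_add_right field_simps)
qed

text \<open>Along the line \<open>u + t *\<^sub>R d\<close>, \<open>Q_upper\<close> bounds the
  increment of \<open>Q\<close> by a quadratic polynomial in \<open>t\<close> without constant term;
  minimality forces its linear coefficient to vanish.\<close>

lemma minimizer_gradQ_eq_0:
  assumes "global_minimizer Q u"
  shows "gradQ u = 0"
proof -
  have "gradQ u \<bullet> d = 0" for d
  proof (rule linear_coefficient_eq_0)
    let ?C = "1 / 2 * (d \<bullet> (A *v d)) + (\<Sum>j\<in>J. L $ j $ j * \<gamma> / 2 * ((S *v d) $ j)\<^sup>2)"
    fix t :: real
    have "Q u \<le> Q (u + t *\<^sub>R d)"
      using assms by (auto simp: global_minimizer_def)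
    also have "\<dots> \<le> Q u + (t * (gradQ u \<bullet> d) + t\<^sup>2 * ?C)"
      using Q_upper[of u "t *\<^sub>R d"]
      by (simp add: matrix_vector_mult_scaleR power_mult_distrib power2_eq_square
          sum_distrib_left algebra_simps)
    finally show "0 \<le> t * (gradQ u \<bullet> d) + t\<^sup>2 * ?C" by simp
  qed
  from this[of "gradQ u"] show ?thesis by simp
qed

text \<open>Existence comes from compactness of a large ball, uniqueness from \<open>Q_lower\<close>
  at a point where the gradient vanishes.\<close>

lemma ex1_minimizer: "\<exists>!u. global_minimizer Q u"
proof -
  obtain c where c: "c > 0" "\<And>v. c * (norm v)\<^sup>2 \<le> v \<bullet> (A *v v)"
    using pos_def_coercive pos_def by blast
  \<comment> \<open>Beyond this radius the quadratic term of \<open>Q_lower\<close> at 0 dominates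
    the linear one.\<close>
  define R where "R = 2 * norm (gradQ 0) / c"
  have far: "Q 0 \<le> Q v" if "v \<notin> cball 0 R" for v
  proof -
    have "norm (gradQ 0) \<le> c / 2 * norm v"
      using that c by (simp add: R_def field_simps)
    then have "norm (gradQ 0) * norm v \<le> c / 2 * norm v * norm v"
      by (rule mult_right_mono) simp
    also have "\<dots> \<le> 1 / 2 * (v \<bullet> (A *v v))"
      using c(2)[of v] by (simp add: power2_eq_square)
    finally have "- (gradQ 0 \<bullet> v) \<le> 1 / 2 * (v \<bullet> (A *v v))"
      using norm_cauchy_schwarz[of "- gradQ 0" v] by simp
    then show ?thesis using Q_lower[of 0 v] by simp
  qed
  have "R \<ge> 0" using c by (simp add: R_def)
  have "continuous_on (cball 0 R) Q"
    unfolding penalized_objective_def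
    by (intro continuous_intros matrix_vector_mult_linear_continuous_on)
  moreover have zero: "0 \<in> cball (0::real^'b) R" using \<open>R \<ge> 0\<close> by simp
  ultimately obtain u where "\<And>v. v \<in> cball 0 R \<Longrightarrow> Q u \<le> Q v"
    using continuous_attains_inf[OF compact_cball] by (metis empty_iff)
  \<comment> \<open>The minimizer over the ball is no worse than 0, which is no worse than any point
    outside.\<close>
  with zero far  have "global_minimizer Q u"
    unfolding global_minimizer_def by (meson order_trans)
  moreover have "v = u" if "global_minimizer Q v" for v
  proof (rule ccontr)
    assume "v \<noteq> u"
    then have "0 < (v - u) \<bullet> (A *v (v - u))" by (intro pos_def) simp
    then have "Q u < Q v"
      using Q_lower[of u "v - u"] minimizer_gradQ_eq_0[OF \<open>global_minimizer Q u\<close>] by simp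
    moreover have "Q v \<le> Q u"
      using that by (simp add: global_minimizer_def)
    ultimately show False by simp
  qed
  ultimately show ?thesis by blast
qed

section \<open>The Newton step\<close>

lemma active_matrix_mult:
  "active_matrix S L J m b \<gamma> u *v w
     = (\<chi> j. if j \<in> J \<and> shifted u $ j > 0 then L $ j $ j * w $ j else 0)"
proof -
  have "(\<Sum>k\<in>UNIV. (if j = k \<and> k \<in> J \<and> m $ k + \<gamma> * ((S *v u) $ k - b $ k) > 0
          then L $ k $ k else 0) * w $ k)
      = (\<Sum>k\<in>UNIV. if k = j then (if j \<in> J \<and> shifted u $ j > 0 then L $ j $ j * w $ j else 0) else 0)"
    for j by (rule sum.cong) (auto simp: shifted_def)
  then show ?thesis
    by (simp add: vec_eq_iff active_matrix_def matrix_vector_mult_def)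
qed

text \<open>The active matrix is diagonal with nonnegative entries, so it adds a positive
  semidefinite term to \<open>A\<close>.\<close>

lemma step_matrix_pos_def:
  assumes "v \<noteq> 0"
  shows "0 < v \<bullet> ((A + \<gamma> *\<^sub>R (transpose S ** active_matrix S L J m b \<gamma> u ** S)) *v v)"
proof -
  let ?H = "active_matrix S L J m b \<gamma> u"
  have nonneg: "0 \<le> s * (l * s)" if "0 \<le> l" for s l :: real
    using mult_nonneg_nonneg[OF that zero_le_square[of s]] by (simp add: mult_ac)
  have "v \<bullet> (transpose S *v (?H *v (S *v v))) = (S *v v) \<bullet> (?H *v (S *v v))"
    by (metis dot_lmul_matrix inner_commute transpose_matrix_vector)
  also have "\<dots> \<ge> 0"
    unfolding active_matrix_mult inner_vec_def using weight_nonneg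
    by (intro sum_nonneg) (auto simp: nonneg)
  finally have "0 \<le> v \<bullet> (transpose S *v (?H *v (S *v v)))" .
  then show ?thesis
    using pos_def[OF assms] \<gamma>_pos
    by (simp add: matrix_vector_mult_add_rdistrib scaleR_matrix_vector_assoc[symmetric]
        matrix_vector_mul_assoc[symmetric] inner_add_right add_pos_nonneg
        del: transpose_matrix_vector)
qed

lemma ex1_step: "\<exists>!v. step u v"
proof -
  let ?N = "A + \<gamma> *\<^sub>R (transpose S ** active_matrix S L J m b \<gamma> u ** S)"
  have "v = 0" if "?N *v v = 0" for v
    using step_matrix_pos_def[of v u] that by force
  then have "invertible ?N"
    by (simp add: invertible_left_inverse matrix_left_invertible_ker)
  then have "\<exists>!v. ?N *v v = w" for w
    by (simp add: invertible_eq_bij bij_iff)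
  then show ?thesis by (simp add: newton_step_def Let_def)
qed

text \<open>The gradient is piecewise affine, and a Newton step solves the affine system of the piece
  containing \<open>u\<close>. Near a zero \<open>w\<close> of the gradient, the closure of that piece contains \<open>w\<close>:
  the weights of \<open>u\<close> and \<open>w\<close> can differ only where \<open>shifted w\<close> vanishes.\<close>

lemma step_near_minimizer:
  assumes "gradQ w = 0"
  shows "\<forall>\<^sub>F u in nhds w. step u w"
proof -
  have "continuous_on UNIV (\<lambda>u. shifted u $ j)" for j
    unfolding shifted_def by (intro continuous_intros matrix_vector_mult_linear_continuous_on)
  then have lim: "((\<lambda>u. shifted u $ j) \<longlongrightarrow> shifted w $ j) (nhds w)" for j
    using tendsto_at_iff_tendsto_nhds[of "\<lambda>u. shifted u $ j" w for j]
    by (simp add: continuous_on_eq_continuous_at isCont_def)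
  \<comment> \<open>A nonzero \<open>shifted w $ j\<close> keeps its sign near \<open>w\<close>. If
    it is zero, both sides are 0 whatever the sign at \<open>u\<close>.\<close>
  have "\<forall>\<^sub>F u in nhds w. (if shifted u $ j > 0 then shifted w $ j else 0) = max 0 (shifted w $ j)" for j
  proof (cases "shifted w $ j" "0 :: real" rule: linorder_cases)
    case less
    then show ?thesis
      by (rule eventually_mono[OF order_tendstoD(2)[OF lim]]) (use less in auto)
  next
    case greater
    then show ?thesis
      by (rule eventually_mono[OF order_tendstoD(1)[OF lim]]) (use greater in auto)
  qed simp
  then have "\<forall>\<^sub>F u in nhds w. \<forall>j. (if shifted u $ j > 0 then shifted w $ j else 0) = max 0 (shifted w $ j)"
    by (simp add: eventually_all_finite)
  then show ?thesis
  proof (rule eventually_mono)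
    fix u
    let ?H = "active_matrix S L J m b \<gamma> u"
    assume eq: "\<forall>j. (if shifted u $ j > 0 then shifted w $ j else 0) = max 0 (shifted w $ j)"
    have "?H *v shifted w
        = (\<chi> j. if j \<in> J then L $ j $ j * (if shifted u $ j > 0 then shifted w $ j else 0) else 0)"
      unfolding active_matrix_mult by (auto simp: vec_eq_iff)
    also have "\<dots> = (\<chi> j. if j \<in> J then L $ j $ j * max 0 (shifted w $ j) else 0)"
      by (simp only: eq[rule_format])
    finally have grad: "A *v w + transpose S *v (?H *v shifted w) = f"
      using assms unfolding gradQ_def by (simp add: algebra_simps)
    \<comment> \<open>In the sum \<open>m\<close> and \<open>b\<close> cancel, leaving
      \<open>\<gamma> *\<^sub>R (S *v w)\<close>; this turns the gradient equation into the Newton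
      system.\<close>
    have "?H *v shifted w + ?H *v (\<gamma> *\<^sub>R b - m) = \<gamma> *\<^sub>R (?H *v (S *v w))"
      by (simp add: shifted_def algebra_simps flip: matrix_vector_right_distrib matrix_vector_mult_scaleR)
    then have split: "\<gamma> *\<^sub>R (transpose S *v (?H *v (S *v w)))
        = transpose S *v (?H *v shifted w) + transpose S *v (?H *v (\<gamma> *\<^sub>R b - m))"
      by (metis matrix_vector_right_distrib matrix_vector_mult_scaleR)
    have "(A + \<gamma> *\<^sub>R (transpose S ** ?H ** S)) *v w
        = A *v w + \<gamma> *\<^sub>R (transpose S *v (?H *v (S *v w)))"
      by (simp only: matrix_vector_mult_add_rdistrib scaleR_matrix_vector_assoc[symmetric]
          matrix_vector_mul_assoc[symmetric])
    also have "\<dots> = f + transpose S *v (?H *v (\<gamma> *\<^sub>R b - m))"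
      unfolding split grad[symmetric] by (rule add.assoc[symmetric])
    finally show "step u w"
      by (simp only: newton_step_def Let_def)
  qed
qed

theorem newton_locally_superlinear:
  assumes "global_minimizer Q w"
  shows "\<exists>\<delta>>0. \<forall>U. dist (U 0) w < \<delta> \<and> (\<forall>k. step (U k) (U (Suc k)))
    \<longrightarrow> converges_q_superlinearly U w"
proof -
  obtain \<delta> where \<delta>: "\<delta> > 0" "\<And>u. dist u w < \<delta> \<Longrightarrow> step u w"
    using step_near_minimizer[OF minimizer_gradQ_eq_0[OF assms]]
    unfolding eventually_nhds_metric by blast
  have "converges_q_superlinearly U w"
    if "dist (U 0) w < \<delta>" and steps: "\<And>k. step (U k) (U (Suc k))" for U
  proof -
    \<comment> \<open>Both \<open>w\<close> and the iterate solve the same uniquely solvable system.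
      Later steps start at \<open>w\<close>, which lies in its own neighbourhood.\<close>
    have exact: "U (Suc k) = w" for k
    proof (induction k)
      case 0
      show ?case using ex1_step \<delta>(2)[OF that(1)] steps[of 0] by blast
    next
      case (Suc k)
      then show ?case using ex1_step \<delta>(2)[of "U (Suc k)"] \<delta>(1) steps[of "Suc k"] by auto
    qed
    have "U \<longlonglongrightarrow> w"
      by (subst filterlim_sequentially_Suc[symmetric]) (simp add: exact)
    \<comment> \<open>All errors from index 1 on are zero, so the \<open>o\<close> condition
      concerns the zero function.\<close>
    then show ?thesis by (simp add: converges_q_superlinearly_def exact)
  qed
  then show ?thesis using \<delta>(1) by blast
qed

end

section \<open>Definiteness of the finite element matrices\<close>

lemma set_integral_eq_0_imp_zero_in_open:
  fixes g :: "'a::euclidean_space \<Rightarrow> real"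
  assumes int: "set_integrable lebesgue D g" and nonneg: "\<And>z. z \<in> D \<Longrightarrow> 0 \<le> g z"
    and zero: "(LINT z:D|lebesgue. g z) = 0"
    and U: "open U" "U \<subseteq> D" "U \<noteq> {}"
  shows "\<exists>z\<in>U. g z = 0"
proof (rule ccontr)
  assume none: "\<not> (\<exists>z\<in>U. g z = 0)"
  have "AE z in lebesgue. indicator D z *\<^sub>R g z = 0"
    using integral_nonneg_eq_0_iff_AE[OF int[unfolded set_integrable_def]] nonneg zero
    by (simp add: set_lebesgue_integral_def indicator_def)
  \<comment> \<open>Almost every point of an open set lying in a closed set means that all of them
    do; with the empty closed set this contradicts \<open>U \<noteq> {}\<close>.\<close>
  then have "AE z\<in>U in lebesgue. z \<in> {}"
    by (rule eventually_mono) (use none U in \<open>auto simp: indicator_def\<close>)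
  then show False
    using mem_closed_if_AE_lebesgue_open[OF U(1) closed_empty] U(3) by blast
qed

text \<open>Expanding the squared norm of the sum gives the double sum. The lemma serves the
  stiffness, mass and boundary mass matrices alike.\<close>

lemma gram_quadratic_form:
  fixes \<phi> :: "'n::finite \<Rightarrow> 'a \<Rightarrow> 'c::real_inner" and v :: "real^'n"
  assumes "\<And>i j. set_integrable M D (\<lambda>z. \<phi> i z \<bullet> \<phi> j z)"
  defines "w \<equiv> \<lambda>z. (norm (\<Sum>j\<in>UNIV. v $ j *\<^sub>R \<phi> j z))\<^sup>2"
  shows "set_integrable M D w"
    and "(\<Sum>i\<in>UNIV. \<Sum>j\<in>UNIV. v $ i * v $ j * (LINT z:D|M. \<phi> i z \<bullet> \<phi> j z)) = (LINT z:D|M. w z)"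
proof -
  have w: "indicator D z *\<^sub>R w z
      = (\<Sum>i\<in>UNIV. \<Sum>j\<in>UNIV. v $ i * v $ j * (indicator D z *\<^sub>R (\<phi> i z \<bullet> \<phi> j z)))" for z
    by (simp add: w_def power2_norm_eq_inner inner_sum_left inner_sum_right sum_distrib_left mult_ac inner_commute)
  have int: "integrable M (\<lambda>z. v $ i * v $ j * (indicator D z *\<^sub>R (\<phi> i z \<bullet> \<phi> j z)))" for i j
    using assms(1) unfolding set_integrable_def by (rule integrable_mult_right)
  show "set_integrable M D w"
    unfolding set_integrable_def w by (intro Bochner_Integration.integrable_sum int)
  show "(\<Sum>i\<in>UNIV. \<Sum>j\<in>UNIV. v $ i * v $ j * (LINT z:D|M. \<phi> i z \<bullet> \<phi> j z)) = (LINT z:D|M. w z)"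
    unfolding set_lebesgue_integral_def w
    using int assms(1) unfolding set_integrable_def
    by (subst Bochner_Integration.integral_sum, intro Bochner_Integration.integrable_sum int)
       (simp add: Bochner_Integration.integral_sum)
qed

lemma inner_matrix_vector_mult:
  "v \<bullet> (X *v v) = (\<Sum>i\<in>UNIV. \<Sum>j\<in>UNIV. v $ i * v $ j * X $ i $ j)" for X :: "real^'n^'n::finite"
  by (simp add: inner_vec_def matrix_vector_mult_def sum_distrib_left mult_ac)

lemma set_integrable_lebesgue_continuous:
  fixes g :: "'a::euclidean_space \<Rightarrow> real"
  assumes "compact K" "continuous_on K g" "D \<subseteq> K" "D \<in> sets lebesgue"
  shows "set_integrable lebesgue D g"
proof (rule set_integrable_subset)
  have "integrable lborel (\<lambda>x. indicator K x *\<^sub>R g x)"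
    by (rule borel_integrable_compact) fact+
  then show "set_integrable lebesgue K g"
    unfolding set_integrable_def by (subst integrable_completion) auto
qed fact+

text \<open>Justifies the definite description in \<open>gradient\<close>: any derivative found is
  its value.\<close>

lemma gderiv_unique:
  assumes "GDERIV g z :> d" "GDERIV g z :> d'"
  shows "d = d'"
proof -
  have "(\<lambda>h. h \<bullet> d) = (\<lambda>h. h \<bullet> d')"
    using assms unfolding gderiv_def by (rule has_derivative_unique)
  then have "h \<bullet> d = h \<bullet> d'" for h by meson
  then show ?thesis using vector_eq_ldot[of d d'] by blast
qed

lemma gradient_eq: "GDERIV g z :> d \<Longrightarrow> gradient g z = d"
  unfolding gradient_def using gderiv_unique by blast

lemma GDERIV_affine_on:
  assumes "z \<in> interior T" "\<forall>z\<in>T. g z = a \<bullet> z + c"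
  shows "GDERIV g z :> a"
proof -
  have "((\<lambda>z. a \<bullet> z + c) has_derivative (\<lambda>h. h \<bullet> a)) (at z)"
    by (auto intro!: derivative_eq_intros simp: inner_commute)
  then show ?thesis
    unfolding gderiv_def
    by (rule has_derivative_transform_within_open[where s = "interior T"])
       (use assms interior_subset[of T] in auto)
qed

lemma matrix_mult_inv:
  fixes X :: "real^'n^'n::finite"
  assumes "invertible X"
  shows "X ** matrix_inv X = mat 1"
  using someI_ex[OF assms[unfolded invertible_def]] unfolding matrix_inv_def by auto

section \<open>Triangles, nodes and basis functions\<close>

locale fe_problem =
  fixes \<Omega> :: "(real^2) set" and \<T> :: "(real^2) set set" and x :: "'n::finite \<Rightarrow> real^2"
    and \<beta> :: "'b::finite \<Rightarrow> 'n" and e :: "'n \<Rightarrow> real^2 \<Rightarrow> real"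
  assumes domain: "domain \<Omega>" and bounded: "bounded \<Omega>" and convex: "convex \<Omega>"
    and mesh: "mesh_of \<Omega> \<T>"
    and nodes: "bij_betw x UNIV (mesh_nodes \<T>)"
    and boundary_nodes: "bij_betw \<beta> UNIV {j. x j \<in> frontier \<Omega>}"
    and basis: "nodal_basis \<Omega> \<T> x e"
begin

text \<open>The finite element function with nodal vector \<open>v\<close>.\<close>

definition fe :: "real^'n \<Rightarrow> real^2 \<Rightarrow> real" where
  "fe v z = (\<Sum>j\<in>UNIV. v $ j * e j z)"

lemma open_domain: "open \<Omega>"
  using domain by (simp add: domain_def)

lemma lebesgue_sets_domain: "\<Omega> \<in> sets lebesgue"
  using open_domain by simp

lemma compact_closure: "compact (closure \<Omega>)"
  using bounded by simp

lemma e_fe: "e j \<in> fe_space \<Omega> \<T>"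
  using basis by (simp add: nodal_basis_def)

lemma continuous_e: "continuous_on (closure \<Omega>) (e j)"
  using e_fe by (simp add: fe_space_def)

lemma continuous_fe: "continuous_on (closure \<Omega>) (fe v)"
  unfolding fe_def by (intro continuous_intros continuous_e)

lemma e_nodal: "e j (x i) = (if i = j then 1 else 0)"
  using basis by (simp add: nodal_basis_def)

lemma fe_nodal: "fe v (x i) = v $ i"
  by (simp add: fe_def e_nodal if_distrib cong: if_cong)

lemma finite_mesh: "finite \<T>"
  using mesh by (simp add: mesh_of_def triangulation_def)

lemma triangle: "T \<in> \<T> \<Longrightarrow> 2 simplex T"
  using mesh by (simp add: mesh_of_def)

lemma union_mesh: "\<Union>\<T> = closure \<Omega>"
  using mesh by (simp add: mesh_of_def)

text \<open>Convexity enters here: an open convex set is the interior of its closure.\<close>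

lemma interior_triangle_subset: "T \<in> \<T> \<Longrightarrow> interior T \<subseteq> \<Omega>"
  using interior_mono[of T "closure \<Omega>"] union_mesh convex_interior_closure[OF convex] open_domain
  by (auto simp: interior_open)

lemma interior_triangle_nonempty:
  assumes "T \<in> \<T>"
  shows "interior T \<noteq> {}"
proof -
  have T: "2 simplex T" using triangle assms .
  then have "aff_dim T = 2" by (rule aff_dim_simplex)
  then have "affine hull T = UNIV" using aff_dim_eq_full[of T] by simp
  moreover have "rel_interior T \<noteq> {}"
    using \<open>aff_dim T = 2\<close> convex_simplex[OF T] rel_interior_eq_empty by fastforce
  ultimately show ?thesis by (simp add: rel_interior_interior)
qed

lemma node_in_closure: "x j \<in> closure \<Omega>"
proof -
  have "x j \<in> mesh_nodes \<T>" using nodes by (auto simp: bij_betw_def)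
  then show ?thesis using union_mesh by (auto simp: mesh_nodes_def extreme_point_of_def)
qed

lemma boundary_index: "x j \<notin> \<Omega> \<longleftrightarrow> j \<in> range \<beta>"
  using boundary_nodes node_in_closure[of j] open_domain
  by (auto simp: bij_betw_def frontier_def interior_open)

lemma inj_\<beta>: "inj \<beta>"
  using boundary_nodes by (simp add: bij_betw_def)

lemma e_affine:
  assumes "T \<in> \<T>"
  obtains a c where "\<forall>z\<in>T. e j z = a \<bullet> z + c"
  using e_fe assms unfolding fe_space_def by blast

text \<open>On a triangle \<open>e j\<close> is affine, and the triangle is the convex hull of its
  vertices, which are nodes, where \<open>e j\<close> is 0 or 1.\<close>

lemma e_nonneg:
  assumes "z \<in> closure \<Omega>"
  shows "0 \<le> e j z"
proof -
  obtain T where T: "T \<in> \<T>" "z \<in> T" using assms union_mesh by blast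
  obtain a c where ac: "\<forall>z\<in>T. e j z = a \<bullet> z + c" using e_affine[OF T(1)] by blast
  have hull: "T = convex hull {v. v extreme_point_of T}"
    using Krein_Milman_Minkowski[OF compact_simplex convex_simplex] triangle[OF T(1)] by blast
  have "convex hull {v. v extreme_point_of T} \<subseteq> {z. - c \<le> a \<bullet> z}"
  proof (intro hull_minimal convex_halfspace_ge subsetI)
    fix v assume "v \<in> {v. v extreme_point_of T}"
    then have "v \<in> mesh_nodes \<T>" "v \<in> T"
      using T(1) by (auto simp: mesh_nodes_def extreme_point_of_def)
    then obtain i where "v = x i" using nodes by (auto simp: bij_betw_def)
    then have "0 \<le> e j v" by (simp add: e_nodal)
    then show "v \<in> {z. - c \<le> a \<bullet> z}" using ac \<open>v \<in> T\<close> by simp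
  qed
  then have "- c \<le> a \<bullet> z" using T(2) by (subst (asm) hull) blast
  then show ?thesis using ac T(2) by simp
qed

section \<open>Gradients, energy form and Dirichlet matrix\<close>

text \<open>The open set on which the gradients of the basis functions are known; the arbitrary
  values of \<open>gradient\<close> elsewhere in the domain are confined to a null set.\<close>

definition interiors :: "(real^2) set" where
  "interiors = (\<Union>T\<in>\<T>. interior T)"

lemma negligible_interiors: "negligible (\<Omega> - interiors)"
proof (rule negligible_subset)
  show "negligible (\<Union>T\<in>\<T>. frontier T)"
    using finite_mesh triangle convex_simplex negligible_convex_frontier by blast
  show "\<Omega> - interiors \<subseteq> (\<Union>T\<in>\<T>. frontier T)"
  proof
    fix z assume z: "z \<in> \<Omega> - interiors"
    then obtain T where "T \<in> \<T>" "z \<in> T" using union_mesh closure_subset by blast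
    then show "z \<in> (\<Union>T\<in>\<T>. frontier T)"
      using z closure_subset[of T] by (auto simp: interiors_def frontier_def)
  qed
qed

lemma gradient_constant:
  assumes "T \<in> \<T>"
  shows "\<exists>a. \<forall>z\<in>interior T. gradient (e j) z = a"
proof -
  obtain a c where ac: "\<forall>z\<in>T. e j z = a \<bullet> z + c"
    using e_affine[OF assms] by blast
  have "gradient (e j) z = a" if "z \<in> interior T" for z
    using GDERIV_affine_on[OF that ac] by (rule gradient_eq)
  then show ?thesis by blast
qed

lemma gradient_bounded: "\<exists>C. \<forall>z\<in>interiors. norm (gradient (e j) z) \<le> C"
proof -
  obtain a where a: "\<forall>T\<in>\<T>. \<forall>z\<in>interior T. gradient (e j) z = a T"
    using bchoice[of \<T> "\<lambda>T a. \<forall>z\<in>interior T. gradient (e j) z = a"] gradient_constant by blast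
  have "norm (gradient (e j) z) \<le> (\<Sum>T\<in>\<T>. norm (a T))" if z: "z \<in> interiors" for z
  proof -
    obtain T where T: "T \<in> \<T>" "z \<in> interior T" using z by (auto simp: interiors_def)
    then have "norm (gradient (e j) z) = norm (a T)" using a by simp
    also have "\<dots> \<le> (\<Sum>T\<in>\<T>. norm (a T))"
      using finite_mesh T(1) by (intro member_le_sum) auto
    finally show ?thesis .
  qed
  then show ?thesis by blast
qed

lemma continuous_gradient: "continuous_on interiors (gradient (e j))"
  unfolding interiors_def
proof (rule continuous_on_open_UN)
  fix T assume "T \<in> \<T>"
  then obtain a where "\<forall>z\<in>interior T. gradient (e j) z = a"
    using gradient_constant[of T j] by fast
  then show "continuous_on (interior T) (gradient (e j))"
    using continuous_on_cong[of "interior T" "interior T" "gradient (e j)" "\<lambda>_. a"] by simp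
qed simp

text \<open>On \<open>interiors\<close> the integrand is continuous and bounded, and the rest of the
  domain is negligible.\<close>

lemma gradient_integrable: "set_integrable lebesgue \<Omega> (\<lambda>z. gradient (e i) z \<bullet> gradient (e j) z)"
proof (rule absolutely_integrable_spike_set)
  obtain C where C: "\<And>z. z \<in> interiors \<Longrightarrow> norm (gradient (e i) z) \<le> C"
    using gradient_bounded by blast
  obtain C' where C': "\<And>z. z \<in> interiors \<Longrightarrow> norm (gradient (e j) z) \<le> C'"
    using gradient_bounded by blast
  have "open interiors" by (auto simp: interiors_def)
  show "set_integrable lebesgue interiors (\<lambda>z. gradient (e i) z \<bullet> gradient (e j) z)"
    (is "set_integrable _ _ ?g")
  proof (rule set_integrable_bound)
    have "interiors \<subseteq> \<Omega>" using interior_triangle_subset by (auto simp: interiors_def)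
    then show "set_integrable lebesgue interiors (\<lambda>_. C * C')"
      using \<open>open interiors\<close> closure_subset[of \<Omega>]
      by (intro set_integrable_lebesgue_continuous[OF compact_closure]) auto
    have "(\<lambda>z. indicator interiors z *\<^sub>R ?g z) \<in> borel_measurable borel"
      using \<open>open interiors\<close>
      by (intro borel_measurable_continuous_on_indicator continuous_intros continuous_gradient) auto
    then show "set_borel_measurable lebesgue interiors ?g"
      unfolding set_borel_measurable_def by (intro measurable_completion) simp
    show "AE z in lebesgue. z \<in> interiors \<longrightarrow> norm (?g z) \<le> norm (C * C')"
    proof (intro AE_I2 impI)
      fix z assume z: "z \<in> interiors"
      have "\<bar>?g z\<bar> \<le> norm (gradient (e i) z) * norm (gradient (e j) z)"
        by (rule Cauchy_Schwarz_ineq2)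
      also have "\<dots> \<le> C * C'"
        using C[OF z] C'[OF z] norm_ge_zero[of "gradient (e i) z"]
          norm_ge_zero[of "gradient (e j) z"]
        by (intro mult_mono) linarith+
      finally show "norm (?g z) \<le> norm (C * C')" by simp
    qed
  qed
  have "{z \<in> interiors - \<Omega>. gradient (e i) z \<bullet> gradient (e j) z \<noteq> 0} = {}"
    using interior_triangle_subset by (auto simp: interiors_def)
  then show "negligible {z \<in> interiors - \<Omega>. gradient (e i) z \<bullet> gradient (e j) z \<noteq> 0}"
    by (simp only: negligible_empty)
  show "negligible {z \<in> \<Omega> - interiors. gradient (e i) z \<bullet> gradient (e j) z \<noteq> 0}"
    by (rule negligible_subset[OF negligible_interiors]) auto
qed

text \<open>If the energy of \<open>fe v\<close> vanishes, \<open>fe v\<close> is constant on every triangle, so it is a continuous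
  function with finitely many values on the connected closure of the domain.\<close>

lemma stiffness_kernel:
  assumes "v \<bullet> (stiffness_matrix \<Omega> e *v v) = 0"
  shows "v $ i = v $ j"
proof -
  let ?g = "\<lambda>z. \<Sum>j\<in>UNIV. v $ j *\<^sub>R gradient (e j) z"
  note gram = gram_quadratic_form[of lebesgue \<Omega> "\<lambda>j. gradient (e j)" v, OF gradient_integrable]
  have zero: "(LINT z:\<Omega>|lebesgue. (norm (?g z))\<^sup>2) = 0"
    using assms unfolding inner_matrix_vector_mult stiffness_matrix_def by (simp add: gram(2))
  have "\<exists>c. \<forall>z\<in>T. fe v z = c" if "T \<in> \<T>" for T
  proof -
    have "\<exists>a c. \<forall>z\<in>T. e j z = a \<bullet> z + c" for j
      using e_affine[OF \<open>T \<in> \<T>\<close>] by blast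
    then obtain a c where ac: "\<And>j. \<forall>z\<in>T. e j z = a j \<bullet> z + c j"
      by metis
    let ?a = "\<Sum>j\<in>UNIV. v $ j *\<^sub>R a j"
    have fe: "fe v z = ?a \<bullet> z + (\<Sum>j\<in>UNIV. v $ j * c j)" if "z \<in> T" for z
      using ac that by (simp add: fe_def inner_sum_left sum.distrib[symmetric] algebra_simps)
    \<comment> \<open>One such point suffices, since the gradient of \<open>fe v\<close> is constant
      on the interior of \<open>T\<close>.\<close>
    obtain z where z: "z \<in> interior T" "(norm (?g z))\<^sup>2 = 0"
      using set_integral_eq_0_imp_zero_in_open[OF gram(1) _ zero open_interior
        interior_triangle_subset[OF \<open>T \<in> \<T>\<close>] interior_triangle_nonempty[OF \<open>T \<in> \<T>\<close>]] by auto
    have "gradient (e j) z = a j" for j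
      using GDERIV_affine_on[OF z(1) ac] by (rule gradient_eq)
    with z(2) have "?a = 0" by simp
    with fe show ?thesis by auto
  qed
  then obtain c where c: "\<And>T z. T \<in> \<T> \<Longrightarrow> z \<in> T \<Longrightarrow> fe v z = c T" by metis
  have "fe v ` closure \<Omega> \<subseteq> c ` \<T>"
    using c union_mesh by (auto simp flip: union_mesh)
  then have fin: "finite (fe v ` closure \<Omega>)"
    using finite_mesh finite_subset by blast
  have conn: "connected (fe v ` closure \<Omega>)"
    using domain continuous_fe
    by (intro connected_continuous_image connected_imp_connected_closure) (auto simp: domain_def)
  have "fe v (x i) \<in> fe v ` closure \<Omega>" "fe v (x j) \<in> fe v ` closure \<Omega>"
    using node_in_closure by blast+
  then have "fe v (x i) = fe v (x j)"
    using iffD1[OF connected_finite_iff_sing[OF conn] fin] by (elim disjE exE) simp_all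
  then show ?thesis by (simp add: fe_nodal)
qed

text \<open>A kernel vector vanishes at the boundary nodes and its stiffness residual at the
  interior ones. Its energy is therefore zero, so it is constant, and the boundary value makes it
  zero.\<close>

lemma invertible_dirichlet_matrix: "invertible (dirichlet_matrix \<Omega> x e)"
proof -
  have "v = 0" if "dirichlet_matrix \<Omega> x e *v v = 0" for v
  proof -
    have rows: "(dirichlet_matrix \<Omega> x e *v v) $ i
        = (if x i \<in> \<Omega> then (stiffness_matrix \<Omega> e *v v) $ i else v $ i)" for i
      using matrix_vector_mul_lid[of v]
      by (auto simp: dirichlet_matrix_def matrix_vector_mult_def vec_eq_iff)
    have prod: "v $ i * (stiffness_matrix \<Omega> e *v v) $ i = 0" for i
      using rows[of i] that by (auto split: if_splits)
    have "v \<bullet> (stiffness_matrix \<Omega> e *v v) = 0"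
      by (simp only: inner_vec_def inner_real_def prod sum.neutral_const)
    note const = stiffness_kernel[OF this]
    \<comment> \<open>Types are nonempty, so a boundary node exists.\<close>
    fix k :: 'b
    have "x (\<beta> k) \<notin> \<Omega>" using boundary_index by blast
    then have "v $ \<beta> k = 0" using rows[of "\<beta> k"] that by simp
    then show "v = 0" using const by (metis vec_eq_iff zero_index)
  qed
  then show ?thesis by (simp add: invertible_left_inverse matrix_left_invertible_ker)
qed

section \<open>Mass and boundary mass matrices\<close>

lemma mass_integrable: "set_integrable lebesgue \<Omega> (\<lambda>z. e i z * e j z)"
  using continuous_e closure_subset lebesgue_sets_domain
  by (intro set_integrable_lebesgue_continuous[OF compact_closure] continuous_intros) auto

text \<open>The form is the squared L2 norm of \<open>fe v\<close>, a continuous function that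
  determines \<open>v\<close> through its nodal values.\<close>

lemma mass_matrix_pos_def:
  assumes "v \<noteq> 0"
  shows "0 < v \<bullet> (mass_matrix \<Omega> e *v v)"
proof -
  note gram = gram_quadratic_form[of lebesgue \<Omega> e v, unfolded inner_real_def, OF mass_integrable,
      unfolded real_norm_def power2_abs real_scaleR_def, folded fe_def]
  have form: "v \<bullet> (mass_matrix \<Omega> e *v v) = (LINT z:\<Omega>|lebesgue. (fe v z)\<^sup>2)"
    unfolding inner_matrix_vector_mult mass_matrix_def by (simp add: gram(2))
  have "0 \<le> (LINT z:\<Omega>|lebesgue. (fe v z)\<^sup>2)"
    unfolding set_lebesgue_integral_def by (intro integral_nonneg_AE AE_I2) simp
  moreover have "(LINT z:\<Omega>|lebesgue. (fe v z)\<^sup>2) \<noteq> 0"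
  proof
    assume zero: "(LINT z:\<Omega>|lebesgue. (fe v z)\<^sup>2) = 0"
    \<comment> \<open>A nonempty open set of nonzero values would have to contain a zero of
      \<open>fe v\<close>.\<close>
    have "open (\<Omega> \<inter> fe v -` (- {0}))"
      using continuous_on_subset[OF continuous_fe closure_subset] open_domain
      by (intro continuous_open_preimage) auto
    then have "\<Omega> \<inter> fe v -` (- {0}) = {}"
      using set_integral_eq_0_imp_zero_in_open[OF gram(1) _ zero] by fastforce
    then have "fe v z = 0" if "z \<in> \<Omega>" for z using that by blast
    \<comment> \<open>The closure is needed to reach the boundary nodes.\<close>
    then have "fe v z = 0" if "z \<in> closure \<Omega>" for z
      using continuous_constant_on_closure[OF continuous_fe _ that] by blast
    then have "v $ j = 0" for j using node_in_closure fe_nodal by metis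
    with assms show False by (simp add: vec_eq_iff)
  qed
  ultimately show ?thesis using form by linarith
qed

lemma mass_matrix_nonneg: "0 \<le> mass_matrix \<Omega> e $ i $ j"
proof -
  have "0 \<le> indicator \<Omega> z *\<^sub>R (e i z * e j z)" for z
    using e_nonneg subsetD[OF closure_subset[of \<Omega>]] by (cases "z \<in> \<Omega>") auto
  then show ?thesis
    by (simp add: mass_matrix_def set_lebesgue_integral_def)
qed

text \<open>Ensures that the choice of end points in \<open>boundary_integral\<close> picks an
  actual representation of the side.\<close>

lemma edge_is_segment:
  assumes "E edge_of closure \<Omega>"
  shows "\<exists>p q. E = closed_segment p q"
proof -
  have E: "E face_of closure \<Omega>" "aff_dim E = 1" using assms by (auto simp: edge_of_def)
  then have "compact E" "convex E" "collinear E" "E \<noteq> {}"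
    using face_of_imp_compact[OF convex_closure[OF convex] compact_closure] face_of_imp_convex
    by (auto simp: collinear_aff_dim)
  then show ?thesis by (metis compact_convex_collinear_segment)
qed

text \<open>Parametrizing the segment turns this into a Gram form of functions on the unit interval,
  scaled by the length.\<close>

lemma segment_mass_nonneg:
  fixes v :: "real^'b"
  assumes "closed_segment p q \<subseteq> closure \<Omega>"
  shows "0 \<le> (\<Sum>i\<in>UNIV. \<Sum>j\<in>UNIV. v $ i * v $ j * segment_integral p q (\<lambda>z. e (\<beta> i) z * e (\<beta> j) z))"
proof -
  let ?\<phi> = "\<lambda>k t. e (\<beta> k) (linepath p q t)"
  have "continuous_on {0..1} (?\<phi> k)" for k
    using continuous_e assms
    by (intro continuous_on_compose2[OF continuous_e] continuous_on_linepath)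
      (auto simp: linepath_image_01[symmetric])
  then have "set_integrable lebesgue {0..1} (\<lambda>t. ?\<phi> i t \<bullet> ?\<phi> j t)" for i j
    by (intro set_integrable_lebesgue_continuous[of "{0..1}"] continuous_intros) auto
  note gram = gram_quadratic_form(2)[of lebesgue "{0..1}" ?\<phi> v, OF this]
  have "0 \<le> (\<Sum>i\<in>UNIV. \<Sum>j\<in>UNIV. v $ i * v $ j * (LINT t:{0..1}|lebesgue. ?\<phi> i t \<bullet> ?\<phi> j t))"
    unfolding gram unfolding set_lebesgue_integral_def by (intro integral_nonneg_AE AE_I2) simp
  then have "0 \<le> dist p q * \<dots>" by simp
  then show ?thesis
    by (simp add: segment_integral_def sum_distrib_left mult_ac)
qed

lemma boundary_mass_nonneg:
  "0 \<le> v \<bullet> (submatrix_via (boundary_mass_matrix \<Omega> e) \<beta> \<beta> *v v)"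
proof -
  let ?I = "\<lambda>E g. let (p, q) = (SOME (p, q). E = closed_segment p q) in segment_integral p q g"
  let ?t = "\<lambda>i j E. v $ i * v $ j * ?I E (\<lambda>z. e (\<beta> i) z * e (\<beta> j) z)"
  have "v \<bullet> (submatrix_via (boundary_mass_matrix \<Omega> e) \<beta> \<beta> *v v)
      = (\<Sum>i\<in>UNIV. \<Sum>j\<in>UNIV. \<Sum>E | E edge_of closure \<Omega>. ?t i j E)"
    unfolding inner_matrix_vector_mult submatrix_via_def boundary_mass_matrix_def
      boundary_integral_def by (simp add: sum_distrib_left)
  also have "\<dots> = (\<Sum>E | E edge_of closure \<Omega>. \<Sum>i\<in>UNIV. \<Sum>j\<in>UNIV. ?t i j E)"
    by (simp only: sum.swap[of _ "{E. E edge_of closure \<Omega>}"])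
  also have "\<dots> \<ge> 0"
  proof (rule sum_nonneg)
    fix E assume "E \<in> {E. E edge_of closure \<Omega>}"
    then have E: "E edge_of closure \<Omega>" by simp
    obtain p q where pq: "(SOME (p, q). E = closed_segment p q) = (p, q)" by fastforce
    have "\<exists>w. case w of (p, q) \<Rightarrow> E = closed_segment p q"
      using edge_is_segment[OF E] by auto
    from someI_ex[OF this] have "closed_segment p q \<subseteq> closure \<Omega>"
      using pq edge_of_imp_subset[OF E] by simp
    from segment_mass_nonneg[OF this] show "0 \<le> (\<Sum>i\<in>UNIV. \<Sum>j\<in>UNIV. ?t i j E)"
      by (simp add: pq)
  qed
  finally show ?thesis .
qed

section \<open>Harmonic extension and control matrix\<close>

abbreviation "S \<equiv> harmonic_extension_matrix \<Omega> x \<beta> e"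

text \<open>Applying the Dirichlet matrix to \<open>S *v v\<close> gives back \<open>v\<close>
  placed at the boundary indices, from which row \<open>\<beta> k\<close> reads off
  \<open>v $ k\<close>.\<close>

lemma harmonic_extension_inj:
  assumes "S *v v = 0"
  shows "v = 0"
proof -
  have "dirichlet_matrix \<Omega> x e *v (S *v v) = submatrix_via (mat 1) id \<beta> *v v"
    using matrix_mult_inv[OF invertible_dirichlet_matrix]
    by (simp add: harmonic_extension_matrix_def matrix_vector_mul_assoc matrix_mul_assoc)
  then have zero: "submatrix_via (mat 1) id \<beta> *v v = 0" using assms by simp
  have "(submatrix_via (mat 1) id \<beta> *v v) $ \<beta> k = v $ k" for k
  proof -
    have "(submatrix_via (mat 1) id \<beta> *v v) $ \<beta> k = (\<Sum>l\<in>UNIV. (if k = l then 1 else 0) * v $ l)"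
      using inj_\<beta> by (simp add: submatrix_via_def matrix_vector_mult_def mat_def inj_eq)
    then show ?thesis by (simp add: if_distrib[of "\<lambda>t. t * _"] cong: if_cong)
  qed
  with zero show ?thesis by (simp add: vec_eq_iff)
qed

text \<open>Strict positivity comes from the mass term and injectivity of \<open>S\<close>, so the
  case \<open>\<nu> = 0\<close> is covered; the boundary term is only nonnegative.\<close>

lemma control_matrix_pos_def:
  assumes "v \<noteq> 0" "\<nu> \<ge> 0"
  shows "0 < v \<bullet> (control_matrix \<Omega> x \<beta> e \<nu> *v v)"
proof -
  let ?M = "mass_matrix \<Omega> e"
  have "v \<bullet> (transpose S *v (?M *v (S *v v))) = (S *v v) \<bullet> (?M *v (S *v v))"
    by (metis dot_lmul_matrix inner_commute transpose_matrix_vector)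
  also have "\<dots> > 0"
    using harmonic_extension_inj assms(1) by (intro mass_matrix_pos_def) blast
  finally have "0 < v \<bullet> (transpose S *v (?M *v (S *v v)))" .
  then show ?thesis
    using boundary_mass_nonneg[of v] assms(2)
    by (simp add: control_matrix_def Let_def matrix_vector_mult_add_rdistrib
        scaleR_matrix_vector_assoc[symmetric] matrix_vector_mul_assoc[symmetric]
        inner_add_right add_pos_nonneg del: transpose_matrix_vector)
qed

lemma control_matrix_symmetric: "transpose (control_matrix \<Omega> x \<beta> e \<nu>) = control_matrix \<Omega> x \<beta> e \<nu>"
proof -
  have M: "transpose (mass_matrix \<Omega> e) = mass_matrix \<Omega> e"
    by (simp add: transpose_def mass_matrix_def vec_eq_iff mult.commute)
  have B: "transpose (submatrix_via (boundary_mass_matrix \<Omega> e) \<beta> \<beta>)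
      = submatrix_via (boundary_mass_matrix \<Omega> e) \<beta> \<beta>"
    by (simp add: transpose_def submatrix_via_def boundary_mass_matrix_def vec_eq_iff mult.commute)
  have "transpose (X + \<nu> *\<^sub>R Y) = transpose X + \<nu> *\<^sub>R transpose Y" for X Y :: "real^'b^'b"
    by (simp add: transpose_def vec_eq_iff)
  then show ?thesis
    by (simp add: control_matrix_def Let_def B M matrix_transpose_mul transpose_transpose matrix_mul_assoc)
qed

lemma lumped_matrix_nonneg: "0 \<le> lumped_matrix \<Omega> e J $ j $ j"
  by (simp add: lumped_matrix_def sum_nonneg mass_matrix_nonneg)

end

section \<open>Local superlinear convergence for the discrete problem\<close>

text \<open>Unique existence of the minimizer and of each Newton step is part of the conclusion,
  because speaking of the solution and of the method presupposes both.\<close>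

theorem theorem5p5:
  fixes \<Omega> \<omega> :: "(real^2) set"
    and \<T> :: "(real^2) set set"
    and x :: "'n::finite \<Rightarrow> real^2"
    and \<beta> :: "'b::finite \<Rightarrow> 'n"
    and e :: "'n \<Rightarrow> real^2 \<Rightarrow> real"
    and b y\<^sub>\<Omega> p \<mu> :: "real^2 \<Rightarrow> real"
    and bv :: "real^'n"
    and \<gamma> \<nu> :: real
  assumes "domain \<Omega>" and "bounded \<Omega>" and "convex \<Omega>" and "polygonal_boundary \<Omega>"
    and "domain \<omega>" and "closure \<omega> \<subseteq> \<Omega>"
    and "continuous_on (closure \<omega>) b"
    and "square_integrable_on \<Omega> y\<^sub>\<Omega>"
    and "mesh_of \<Omega> \<T>"
    and "bij_betw x UNIV (mesh_nodes \<T>)"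
    and "bij_betw \<beta> UNIV {j. x j \<in> frontier \<Omega>}"
    and "nodal_basis \<Omega> \<T> x e"
    and "L2_projection \<Omega> \<T> y\<^sub>\<Omega> p"
    and "\<mu> \<in> fe_space \<Omega> \<T>" and "\<forall>j. x j \<notin> closure \<omega> \<longrightarrow> \<mu> (x j) = 0"
    and "\<forall>j. x j \<in> closure \<omega> \<longrightarrow> bv $ j = b (x j)"
    and "\<gamma> > 0" and "\<nu> \<ge> 0"
  shows "let J = {j. x j \<in> closure \<omega>};
             S = harmonic_extension_matrix \<Omega> x \<beta> e;
             A = control_matrix \<Omega> x \<beta> e \<nu>;
             f = transpose S *v (mass_matrix \<Omega> e *v nodal_vector x p);
             L = lumped_matrix \<Omega> e J;
             m = nodal_vector x \<mu>;
             Q = penalized_objective A f S L J m bv \<gamma>;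
             step = newton_step A f S L J m bv \<gamma>
         in (\<exists>!u. global_minimizer Q u) \<and>
            (\<forall>u. \<exists>!v. step u v) \<and>
            (\<forall>u. global_minimizer Q u \<longrightarrow>
               (\<exists>\<delta>>0. \<forall>U. dist (U 0) u < \<delta> \<and> (\<forall>k. step (U k) (U (Suc k)))
                  \<longrightarrow> converges_q_superlinearly U u))"
proof -
  interpret fe_problem \<Omega> \<T> x \<beta> e
    by unfold_locales fact+
  let ?J = "{j. x j \<in> closure \<omega>}"
  interpret penalized_problem "control_matrix \<Omega> x \<beta> e \<nu>"
    "transpose S *v (mass_matrix \<Omega> e *v nodal_vector x p)" S "lumped_matrix \<Omega> e ?J" ?J
    "nodal_vector x \<mu>" bv \<gamma>
    by unfold_locales
      (use control_matrix_symmetric control_matrix_pos_def lumped_matrix_nonneg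
        \<open>\<gamma> > 0\<close> \<open>\<nu> \<ge> 0\<close> in auto)
  show ?thesis
    unfolding Let_def using ex1_minimizer ex1_step newton_locally_superlinear by blast
qed

end
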